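(* Let $P=(V,\leq)$ be a finite ordered set and let $x,y,z\in V$ be three distinct elements such that $x<z$ and $y$ is incomparable to both $x$ and $z$. Suppose that $(y,z)$ is a critical pair of $P$, and let $Q=P\vee(y,z)$. Then $$\mathbb{P}_Q(x<y)<\mathbb{P}_P(x<y)\leq\frac{2\,\mathbb{P}_Q(x<y)}{1+\mathbb{P}_Q(x<y)}.$$
   Context: For $u\in V$, $D(u)=\{v: v<u\}$, $U(u)=\{v: u<v\}$. An incomparable pair $(a,b)$ is critical if $U(b)\subseteq U(a)$ and $D(a)\subseteq D(b)$. For $(a,b)$ with $b\not< a$, $P\vee(a,b)$ is the order $P\cup\{(u,v): u\leq a \text{ and } b\leq v \text{ in } P\}$ (transitive closure of $P$ with $a<b$ added). For an ordered set $R$, $\mathbb{P}_R(x<y)$ is the proportion of linear extensions of $R$ that put $x$ before $y$. *)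

theory Defs
  imports Complex_Main
begin

text \<open>A finite ordered set is a carrier \<open>V\<close> together with its reflexive order relation \<open>P\<close>, related by
  \<open>partial_order_on V P\<close>. The strict down-set \<open>D(u)\<close> and up-set \<open>U(u)\<close> are the library's
  \<open>underS P u\<close> and \<open>aboveS P u\<close>.\<close>

definition incomparable :: "'a rel \<Rightarrow> 'a \<Rightarrow> 'a \<Rightarrow> bool" where
  "incomparable P a b \<longleftrightarrow> (a, b) \<notin> P \<and> (b, a) \<notin> P"

definition critical_pair :: "'a rel \<Rightarrow> 'a \<Rightarrow> 'a \<Rightarrow> bool" where
  "critical_pair P a b \<longleftrightarrow>
     incomparable P a b \<and> aboveS P b \<subseteq> aboveS P a \<and> underS P a \<subseteq> underS P b"

text \<open>\<open>order_join P a b\<close> is \<open>P \<or> (a, b)\<close>; it is only meaningful when \<open>b\<close> is not strictly below \<open>a\<close>.\<close>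

definition order_join :: "'a rel \<Rightarrow> 'a \<Rightarrow> 'a \<Rightarrow> 'a rel" where
  "order_join P a b = P \<union> {(u, v). (u, a) \<in> P \<and> (b, v) \<in> P}"

definition linear_extensions :: "'a set \<Rightarrow> 'a rel \<Rightarrow> 'a rel set" where
  "linear_extensions V R = {L. linear_order_on V L \<and> R \<subseteq> L}"

definition prob_before :: "'a set \<Rightarrow> 'a rel \<Rightarrow> 'a \<Rightarrow> 'a \<Rightarrow> real" where
  "prob_before V R x y =
     real (card {L \<in> linear_extensions V R. (x, y) \<in> L \<and> x \<noteq> y}) /
     real (card (linear_extensions V R))"

end

(* Split the linear extensions of P (all of which have x < z) by the place of y: a of them have
   y < x < z, b have x < y < z and c have x < z < y.  Then P_P(x<y) = (b+c)/(a+b+c) and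
   P_Q(x<y) = b/(a+b), so that the left inequality amounts to 0 < ac and the right one to ac <= ab.
   The first holds because y is incomparable to x and z.  For the second, criticality of (y,z) makes
   exchanging y and z an injection from the extensions with x < z < y to those with x < y < z. *)
theory Submission
  imports Defs "HOL-Combinatorics.Transposition"
begin

lemma order_join_partial_order_on:
  assumes "partial_order_on V P" "a \<in> V" "b \<in> V" "(b, a) \<notin> P"
  shows "partial_order_on V (order_join P a b)"
proof -
  note P = partial_order_onD[OF assms(1)]
  have tr: "(u, w) \<in> P" if "(u, v) \<in> P" "(v, w) \<in> P" for u v w
    using P(2) that by (rule transD)
  have "refl_on V (order_join P a b)" "order_join P a b \<subseteq> V \<times> V"
    using P(1,4) by (auto simp: refl_on_def order_join_def)
  moreover have "trans (order_join P a b)"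
    unfolding trans_def order_join_def using tr by blast
  \<comment> \<open>Any two-element cycle through an added pair chains up to
    \<open>(b, a) \<in> P\<close>, which the last hypothesis excludes.\<close>
  moreover have "antisym (order_join P a b)"
    unfolding antisym_def order_join_def using antisymD[OF P(3)] tr assms(4) by blast
  ultimately show ?thesis
    by (simp add: partial_order_on_def preorder_on_def)
qed

lemma order_join_mem:
  assumes "partial_order_on V P" "a \<in> V" "b \<in> V"
  shows "(a, b) \<in> order_join P a b"
  using partial_order_onD(1)[OF assms(1)] assms(2,3) by (simp add: order_join_def refl_on_def)

lemma finite_linear_extensions:
  assumes "finite V"
  shows "finite (linear_extensions V P)"
proof (rule finite_subset)
  show "linear_extensions V P \<subseteq> Pow (V \<times> V)"
    by (auto simp: linear_extensions_def order_on_defs)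
qed (use assms in simp)

text \<open>Szpilrajn's theorem for finite orders: a maximal partial order on \<open>V\<close> above
  \<open>P\<close> is total, since \<open>order_join\<close> would enlarge it at any incomparable
  pair.\<close>

lemma linear_extension_exists:
  assumes "finite V" "partial_order_on V P"
  shows "linear_extensions V P \<noteq> {}"
proof -
  let ?A = "{R. partial_order_on V R}"
  have "?A \<subseteq> Pow (V \<times> V)"
    by (auto simp: order_on_defs)
  then have "finite ?A"
    using assms(1) finite_subset by blast
  then obtain M where M: "partial_order_on V M" "P \<subseteq> M"
    and max: "\<And>R. partial_order_on V R \<Longrightarrow> M \<subseteq> R \<Longrightarrow> M = R"
    using finite_has_maximal2[of ?A P] assms(2) by auto
  have "(a, b) \<in> M" if ab: "a \<in> V" "b \<in> V" "(b, a) \<notin> M" for a b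
  proof -
    have "M = order_join M a b"
      using max[OF order_join_partial_order_on[OF M(1) ab]] by (auto simp: order_join_def)
    then show ?thesis
      using order_join_mem[OF M(1) ab(1,2)] by simp
  qed
  then have "total_on V M"
    by (auto simp: total_on_def)
  then show ?thesis
    using M by (auto simp: linear_extensions_def linear_order_on_def)
qed

text \<open>Transitivity along u \<le> a \<le> b \<le> v forces every added pair. Hence both
  probabilities can be computed inside the linear extensions of \<open>P\<close>.\<close>

lemma linear_extensions_order_join:
  assumes "partial_order_on V P" "a \<in> V" "b \<in> V"
  shows "linear_extensions V (order_join P a b) = {L \<in> linear_extensions V P. (a, b) \<in> L}"
proof -
  have "order_join P a b \<subseteq> L" if "linear_order_on V L" "P \<subseteq> L" "(a, b) \<in> L" for L
  proof -
    have "trans L"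
      using that(1) by (simp add: order_on_defs)
    then show ?thesis
      using that(2,3) by (auto simp: order_join_def dest: transD)
  qed
  moreover have "P \<subseteq> order_join P a b"
    by (auto simp: order_join_def)
  ultimately show ?thesis
    using order_join_mem[OF assms] by (auto simp: linear_extensions_def)
qed

lemma linear_extension_reversing_exists:
  assumes "finite V" "partial_order_on V P" "a \<in> V" "b \<in> V" "(b, a) \<notin> P"
  shows "\<exists>L \<in> linear_extensions V P. (a, b) \<in> L"
  using linear_extension_exists[OF assms(1) order_join_partial_order_on[OF assms(2-5)]]
  by (auto simp: linear_extensions_order_join[OF assms(2-4)])

text \<open>Relabelling by a permutation of \<open>V\<close>. For a transposition, the pullback
  exchanges the places of two elements in \<open>L\<close>.\<close>

lemma linear_order_on_inv_image:
  assumes "linear_order_on V L" "bij t" "t ` V = V"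
  shows "linear_order_on V (inv_image L t)"
proof -
  have "inj t"
    using assms(2) by (simp add: bij_def)
  moreover have V: "t u \<in> V \<longleftrightarrow> u \<in> V" for u
    using assms(3) \<open>inj t\<close> by (metis inj_image_mem_iff)
  moreover have L: "L \<subseteq> V \<times> V" "refl_on V L" "trans L" "antisym L" "total_on V L"
    using assms(1) by (auto simp: order_on_defs)
  moreover have "antisym (inv_image L t)"
    using antisymD[OF L(4)] injD[OF \<open>inj t\<close>] by (auto simp: antisym_def inv_image_def)
  ultimately show ?thesis
    by (auto simp: order_on_defs refl_on_def total_on_def inj_eq intro: trans_inv_image)
qed

text \<open>Exchanging \<open>y\<close> and \<open>z\<close> affects only the relations of
  \<open>P\<close> that involve one of them. Those above \<open>z\<close> or below \<open>y\<close>
  survive by criticality; those above \<open>y\<close> or below \<open>z\<close> survive because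
  \<open>L\<close> already has \<open>z\<close> before \<open>y\<close>.\<close>

lemma critical_pair_swap:
  assumes P: "partial_order_on V P" and yz: "y \<in> V" "z \<in> V"
    and crit: "critical_pair P y z"
    and L: "L \<in> linear_extensions V P" "(z, y) \<in> L"
  shows "inv_image L (transpose y z) \<in> linear_extensions V P"
proof -
  have lin: "linear_order_on V L" and PL: "P \<subseteq> L"
    using L(1) by (auto simp: linear_extensions_def)
  then have tr: "(u, w) \<in> L" if "(u, v) \<in> L" "(v, w) \<in> L" for u v w
    using that by (meson order_on_defs transD)
  have rfl: "(y, y) \<in> L" "(z, z) \<in> L"
    using lin yz by (auto simp: order_on_defs refl_on_def)
  have ne: "(y, z) \<notin> P" "(z, y) \<notin> P"
    using crit by (auto simp: critical_pair_def incomparable_def)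
  have up: "(y, v) \<in> P" if "(z, v) \<in> P" "v \<noteq> z" for v
    using crit that by (auto simp: critical_pair_def aboveS_def)
  have down: "(u, z) \<in> P" if "(u, y) \<in> P" "u \<noteq> y" for u
    using crit that by (auto simp: critical_pair_def underS_def)
  have "(transpose y z u, transpose y z v) \<in> L" if uv: "(u, v) \<in> P" for u v
    using uv up[of v] down[of u] tr[OF L(2), of v] tr[OF _ L(2), of u] ne rfl PL
    by (cases "u = y"; cases "u = z"; cases "v = y"; cases "v = z") auto
  moreover have "linear_order_on V (inv_image L (transpose y z))"
    using lin yz by (intro linear_order_on_inv_image) auto
  ultimately show ?thesis
    by (auto simp: linear_extensions_def)
qed

lemma prob_ratio_bounds:
  fixes a b c :: nat
  assumes "0 < a" "0 < c" "c \<le> b"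
  defines "p \<equiv> real (b + c) / real (a + b + c)" and "q \<equiv> real b / real (a + b)"
  shows "q < p" and "p \<le> 2 * q / (1 + q)"
proof -
  \<comment> \<open>The right side exceeds the left by ac.\<close>
  have "real b * real (a + b + c) < real (b + c) * real (a + b)"
    using assms(1,2) by (simp add: algebra_simps)
  then show "q < p"
    using assms(1) by (simp add: p_def q_def divide_less_eq less_divide_eq field_simps)
  have "1 + q = real (a + 2 * b) / real (a + b)"
    using assms(1) by (simp add: q_def field_simps)
  then have "2 * q / (1 + q) = 2 * real b / real (a + 2 * b)"
    using assms(1) by (simp add: q_def)
  \<comment> \<open>Cross-multiplying p \<le> 2b/(a + 2b) leaves exactly this inequality.\<close>
  moreover have "real a * real c \<le> real a * real b"
    using assms(3) by (intro mult_left_mono) auto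
  then have "p \<le> 2 * real b / real (a + 2 * b)"
    using assms(1) by (simp add: p_def divide_le_eq le_divide_eq field_simps)
  ultimately show "p \<le> 2 * q / (1 + q)"
    by simp
qed

theorem theorem4:
  fixes V :: "'a set" and P Q :: "'a rel" and x y z :: 'a
  assumes "finite V" and "partial_order_on V P"
    and "x \<in> V" and "y \<in> V" and "z \<in> V"
    and "x \<noteq> y" and "x \<noteq> z" and "y \<noteq> z"
    and "(x, z) \<in> P"
    and "incomparable P y x" and "incomparable P y z"
    and "critical_pair P y z"
    and "Q = order_join P y z"
  shows "prob_before V Q x y < prob_before V P x y \<and>
    prob_before V P x y \<le> 2 * prob_before V Q x y / (1 + prob_before V Q x y)"
proof -
  let ?E = "linear_extensions V P"
  \<comment> \<open>One condition is enough for \<open>A\<close> and for \<open>C\<close>: as x < z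
    always holds, y < x gives y < z, and z < y gives x < y.\<close>
  define A where "A = {L \<in> ?E. (y, x) \<in> L}"
  define B where "B = {L \<in> ?E. (x, y) \<in> L \<and> (y, z) \<in> L}"
  define C where "C = {L \<in> ?E. (z, y) \<in> L}"
  have xz: "(x, z) \<in> L" if "L \<in> ?E" for L
    using that assms(9) by (auto simp: linear_extensions_def)
  have tr: "(u, w) \<in> L" if "L \<in> ?E" "(u, v) \<in> L" "(v, w) \<in> L" for L u v w
    using that by (auto simp: linear_extensions_def order_on_defs dest: transD)
  have as: "u = v" if "L \<in> ?E" "(u, v) \<in> L" "(v, u) \<in> L" for L u v
    using that by (auto simp: linear_extensions_def order_on_defs dest: antisymD)
  have tot: "(u, v) \<in> L \<or> (v, u) \<in> L" if "L \<in> ?E" "u \<in> V" "v \<in> V" "u \<noteq> v" for L u v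
    using that by (auto simp: linear_extensions_def linear_order_on_def total_on_def)
  have fin: "finite A" "finite B" "finite C"
    using finite_linear_extensions[OF assms(1)] by (auto simp: A_def B_def C_def)
  have "?E = A \<union> B \<union> C"
    using tot[OF _ assms(3,4,6)] tot[OF _ assms(4,5,8)] by (auto simp: A_def B_def C_def)
  moreover have P_before: "{L \<in> ?E. (x, y) \<in> L \<and> x \<noteq> y} = B \<union> C"
    using tot[OF _ assms(4,5,8)] tr[OF _ xz] assms(6) by (auto simp: B_def C_def)
  moreover have Q_ext: "linear_extensions V Q = {L \<in> ?E. (y, z) \<in> L}"
    using linear_extensions_order_join[OF assms(2,4,5)] assms(13) by simp
  then have "linear_extensions V Q = A \<union> B"
    using tot[OF _ assms(3,4,6)] tr[OF _ _ xz] by (auto simp: A_def B_def)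
  moreover have "{L \<in> linear_extensions V Q. (x, y) \<in> L \<and> x \<noteq> y} = B"
    using Q_ext assms(6) by (auto simp: B_def)
  moreover have "A \<inter> B = {}" "A \<inter> C = {}" "B \<inter> C = {}"
    using as[of _ x y] as[of _ y z] tr[OF _ _ xz, of _ y] assms(6,8)
    by (auto simp: A_def B_def C_def)
  ultimately have p: "prob_before V P x y = real (card B + card C) / real (card A + card B + card C)"
    and q: "prob_before V Q x y = real (card B) / real (card A + card B)"
    using fin by (simp_all add: prob_before_def card_Un_disjoint Int_Un_distrib2)
  \<comment> \<open>Since \<open>P\<close> has neither x < y nor y < z, each of these can be
    reversed in some linear extension.\<close>
  have "A \<noteq> {}" "C \<noteq> {}"
    using linear_extension_reversing_exists[OF assms(1,2,4,3)]
      linear_extension_reversing_exists[OF assms(1,2,5,4)] assms(10,11)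
    by (auto simp: A_def C_def incomparable_def)
  then have "0 < card A" "0 < card C"
    using fin by (simp_all add: card_gt_0_iff)
  moreover have "card C \<le> card B"
  proof (rule card_inj_on_le)
    let ?s = "\<lambda>L. inv_image L (transpose y z)"
    show "inj_on ?s C"
    proof (rule inj_on_inverseI)
      \<comment> \<open>The exchange is an involution, hence its own left inverse.\<close>
      show "?s (?s L) = L" for L
        by (auto simp: inv_image_def)
    qed
    \<comment> \<open>The transposition fixes \<open>x\<close>, so x < z and z < y in
      \<open>L\<close> become x < y and y < z in the image.\<close>
    show "?s ` C \<subseteq> B"
      using critical_pair_swap[OF assms(2,4,5,12)] xz assms(6,7)
      by (auto simp: B_def C_def)
    show "finite B"
      by (fact fin)
  qed
  ultimately show ?thesis
    unfolding p q using prob_ratio_bounds by blast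
qed

end
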